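(* Let $X_1,\dots,X_n$ be exchangeable real random variables with finite expected value, and let $k,j\ge 1$ be integers with $k+j\le n$. Then $$\Delta^{j}\mu_k=\binom{k+j}{j}^{-1}(-1)^{j+1}\left(\mu_{k+1:k+j}-\mu_{k:k+j}\right).$$
   Context: For $1\le l\le m\le n$, $\mu_{l:m}=\mathbb{E}[X_l\mid X_1\le\dots\le X_m]$, where the conditioning event refers to the total ranking of $X_1,\dots,X_m$ by value with ties broken at random; equivalently, $\mu_{l:m}$ is the expected value of the $l$-th smallest among $X_1,\dots,X_m$ (the $l$-th order statistic, counted with multiplicity). For $1\le k\le n$, $\mu_k=\mu_{k:k}=\mathbb{E}[\max\{X_1,\dots,X_k\}]$. The discrete derivatives of the sequence $(\mu_k)_{k=1,\dots,n}$ are $\Delta^1\mu_k=\Delta\mu_k=\mu_{k+1}-\mu_k$ and, for $j\ge2$, $\Delta^{j}\mu_k=\Delta^{j-1}\mu_{k+1}-\Delta^{j-1}\mu_k$, defined whenever $k+j\le n$. *)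

theory Defs
  imports "HOL-Probability.Probability" "HOL-Combinatorics.Permutations"
begin

definition exchangeable :: "'a measure \<Rightarrow> (nat \<Rightarrow> 'a \<Rightarrow> real) \<Rightarrow> nat \<Rightarrow> bool" where
  "exchangeable M X n \<longleftrightarrow>
     (\<forall>i\<in>{1..n}. X i \<in> borel_measurable M) \<and>
     (\<forall>p. p permutes {1..n} \<longrightarrow>
        distr M (PiM {1..n} (\<lambda>_. borel)) (\<lambda>\<omega>. \<lambda>i\<in>{1..n}. X (p i) \<omega>) =
        distr M (PiM {1..n} (\<lambda>_. borel)) (\<lambda>\<omega>. \<lambda>i\<in>{1..n}. X i \<omega>))"

text \<open>Random tie-breaking is realised by an auxiliary uniformly distributed permutation \<open>t\<close> of
  \<open>{1..m}\<close>, independent of the given variables: indices are ranked by value, and indices with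
  equal values by their priority under \<open>t\<close>.\<close>

definition tie_breaking_space :: "'a measure \<Rightarrow> nat \<Rightarrow> ('a \<times> (nat \<Rightarrow> nat)) measure" where
  "tie_breaking_space M m =
     M \<Otimes>\<^sub>M measure_pmf (pmf_of_set {t. t permutes {1..m}})"

definition ranked :: "nat \<Rightarrow> (nat \<Rightarrow> real) \<Rightarrow> (nat \<Rightarrow> nat) \<Rightarrow> bool" where
  "ranked m x t \<longleftrightarrow>
     (\<forall>i\<in>{1..<m}. x i < x (Suc i) \<or> (x i = x (Suc i) \<and> t i < t (Suc i)))"

definition ranking_event ::
  "'a measure \<Rightarrow> (nat \<Rightarrow> 'a \<Rightarrow> real) \<Rightarrow> nat \<Rightarrow> ('a \<times> (nat \<Rightarrow> nat)) set" where
  "ranking_event M X m =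
     {(\<omega>, t) \<in> space (tie_breaking_space M m). ranked m (\<lambda>i. X i \<omega>) t}"

text \<open>\<open>mu M X l m\<close> is the expectation of \<open>X l\<close> conditional on \<open>X 1 \<le> \<dots> \<le> X m\<close>, the event being
  understood with ties broken at random.  It equals the expected value of the \<open>l\<close>-th order
  statistic, see \<open>mu_eq_expectation_order_statistic\<close> below.\<close>

definition mu :: "'a measure \<Rightarrow> (nat \<Rightarrow> 'a \<Rightarrow> real) \<Rightarrow> nat \<Rightarrow> nat \<Rightarrow> real" where
  "mu M X l m =
     (LINT z|uniform_measure (tie_breaking_space M m) (ranking_event M X m). X l (fst z))"

definition mu_max :: "'a measure \<Rightarrow> (nat \<Rightarrow> 'a \<Rightarrow> real) \<Rightarrow> nat \<Rightarrow> real" where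
  "mu_max M X k = mu M X k k"

definition discrete_deriv :: "(nat \<Rightarrow> real) \<Rightarrow> nat \<Rightarrow> real" where
  "discrete_deriv f k = f (k + 1) - f k"

definition order_statistic :: "(nat \<Rightarrow> 'a \<Rightarrow> real) \<Rightarrow> nat \<Rightarrow> nat \<Rightarrow> 'a \<Rightarrow> real" where
  "order_statistic X l m \<omega> = sort (map (\<lambda>i. X i \<omega>) [1..<Suc m]) ! (l - 1)"


lemma ranked_less:
  assumes "ranked m x t" "1 \<le> i" "i < j" "j \<le> m"
  shows "x i < x j \<or> (x i = x j \<and> t i < t j)"
  using assms(3,4)
proof (induction j)
  case 0
  then show ?case by simp
next
  case (Suc j)
  have step: "x j < x (Suc j) \<or> (x j = x (Suc j) \<and> t j < t (Suc j))"
    using assms(1,2) Suc.prems unfolding ranked_def by auto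
  show ?case
  proof (cases "i = j")
    case True
    then show ?thesis using step by simp
  next
    case False
    then have "x i < x j \<or> (x i = x j \<and> t i < t j)" using Suc by simp
    then show ?thesis using step by auto
  qed
qed

lemma ex1_ranked_permutation:
  assumes t: "t permutes {1..m}"
  shows "\<exists>!p. p permutes {1..m} \<and> ranked m (\<lambda>i. x (p i)) (\<lambda>i. t (p i))"
proof -
  define le where "le i j \<longleftrightarrow> x i < x j \<or> (x i = x j \<and> t i \<le> t j)" for i j
  define rk where "rk j = card {i\<in>{1..m}. le i j}" for j
  have inj_t: "inj t" using t by (rule permutes_inj)
  have rk_less: "rk i < rk j" if "le i j" "i \<noteq> j" "j \<in> {1..m}" for i j
  proof -
    have "t i \<noteq> t j" using injD[OF inj_t, of i j] that(2) by blast
    then have "\<not> le j i" using that(1) unfolding le_def by auto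
    moreover have "le j j" by (simp add: le_def)
    moreover have "le a j" if "le a i" for a
      using that \<open>le i j\<close> unfolding le_def by auto
    ultimately have "{a\<in>{1..m}. le a i} \<subset> {a\<in>{1..m}. le a j}"
      using that(3) by blast
    then show ?thesis unfolding rk_def by (intro psubset_card_mono) auto
  qed
  have total: "le i j \<or> le j i" for i j unfolding le_def by auto
  have inj_rk: "inj_on rk {1..m}"
  proof (rule inj_onI)
    fix i j assume ij: "i \<in> {1..m}" "j \<in> {1..m}" "rk i = rk j"
    show "i = j"
      using rk_less[of i j] rk_less[of j i] total[of i j] ij by force
  qed
  have "rk ` {1..m} \<subseteq> {1..m}"
  proof
    fix r assume "r \<in> rk ` {1..m}"
    then obtain j where j: "j \<in> {1..m}" "r = rk j" by auto
    have "{i\<in>{1..m}. le i j} \<noteq> {}" using j by (auto simp: le_def)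
    then have "rk j \<noteq> 0" unfolding rk_def by simp
    moreover have "rk j \<le> card {1..m}" unfolding rk_def by (intro card_mono) auto
    ultimately show "r \<in> {1..m}" using j by simp
  qed
  then have "rk ` {1..m} = {1..m}" using inj_rk by (intro endo_inj_surj) auto
  then have bij_rk: "bij_betw rk {1..m} {1..m}" using inj_rk by (simp add: bij_betw_def)
  define p where "p a = (if a \<in> {1..m} then inv_into {1..m} rk a else a)" for a
  have bij_p: "bij_betw p {1..m} {1..m}"
    using bij_betw_inv_into[OF bij_rk] by (rule bij_betw_cong[THEN iffD1, rotated]) (simp add: p_def)
  have perm_p: "p permutes {1..m}"
    using bij_p by (rule bij_imp_permutes) (auto simp: p_def)
  have rk_p: "rk (p a) = a" if "a \<in> {1..m}" for a
    using that bij_rk by (auto simp: p_def bij_betw_inv_into_right)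
  have p_rank: "ranked m (\<lambda>i. x (p i)) (\<lambda>i. t (p i))"
    unfolding ranked_def
  proof
    fix i assume i: "i \<in> {1..<m}"
    have ne: "p i \<noteq> p (Suc i)"
      using injD[OF permutes_inj[OF perm_p], of i "Suc i"] by auto
    have pin: "p i \<in> {1..m}" "p (Suc i) \<in> {1..m}"
      using i permutes_in_image[OF perm_p] by auto
    have "\<not> le (p (Suc i)) (p i)"
    proof
      assume "le (p (Suc i)) (p i)"
      then have "rk (p (Suc i)) < rk (p i)" using rk_less ne pin by metis
      moreover have "rk (p i) = i" "rk (p (Suc i)) = Suc i" using i by (auto intro!: rk_p)
      ultimately show False by linarith
    qed
    then show "x (p i) < x (p (Suc i)) \<or> (x (p i) = x (p (Suc i)) \<and> t (p i) < t (p (Suc i)))"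
      unfolding le_def by auto
  qed
  show ?thesis
  proof (rule ex1I[of _ p])
    show "p permutes {1..m} \<and> ranked m (\<lambda>i. x (p i)) (\<lambda>i. t (p i))"
      using perm_p p_rank by simp
  next
    fix q assume q: "q permutes {1..m} \<and> ranked m (\<lambda>i. x (q i)) (\<lambda>i. t (q i))"
    have qr: "rk (q a) = a" if a: "a \<in> {1..m}" for a
    proof -
      have lt: "x (q i) < x (q j) \<or> (x (q i) = x (q j) \<and> t (q i) < t (q j))"
        if "1 \<le> i" "i < j" "j \<le> m" for i j
        using ranked_less[OF conjunct2[OF q] that] by simp
      have iff: "le (q b) (q a) \<longleftrightarrow> b \<le> a" if b: "b \<in> {1..m}" for b
      proof (cases b a rule: linorder_cases)
        case less
        then show ?thesis using lt[of b a] a b by (auto simp: le_def)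
      next
        case equal
        then show ?thesis by (simp add: le_def)
      next
        case greater
        then show ?thesis using lt[of a b] a b by (auto simp: le_def)
      qed
      have "{i\<in>q ` {1..m}. le i (q a)} = q ` {b\<in>{1..m}. le (q b) (q a)}" by auto
      then have "{i\<in>{1..m}. le i (q a)} = q ` {b\<in>{1..m}. le (q b) (q a)}"
        unfolding permutes_image[OF conjunct1[OF q]] .
      also have "{b\<in>{1..m}. le (q b) (q a)} = {1..a}" using iff a by auto
      finally have "rk (q a) = card (q ` {1..a})" by (simp add: rk_def)
      also have "\<dots> = card {1..a}"
        using permutes_inj_on[OF conjunct1[OF q]] by (rule card_image)
      finally show ?thesis by simp
    qed
    show "q = p"
    proof
      fix a show "q a = p a"
      proof (cases "a \<in> {1..m}")
        case True
        then have "q a \<in> {1..m}" "p a \<in> {1..m}"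
          using permutes_in_image[OF conjunct1[OF q]] permutes_in_image[OF perm_p] by auto
        then show ?thesis 
          using qr[OF True] rk_p[OF True] inj_onD[OF inj_rk, of "q a" "p a"] by simp
      next
        case False
        then show ?thesis
          using permutes_not_in[OF conjunct1[OF q] False] permutes_not_in[OF perm_p False] by simp
      qed
    qed
  qed
qed

lemma order_statistic_eq_ranked:
  assumes p: "p permutes {1..m}" and r: "ranked m (\<lambda>i. X (p i) \<omega>) t"
    and l: "1 \<le> l" "l \<le> m"
  shows "order_statistic X l m \<omega> = X (p l) \<omega>"
proof -
  have "sort (map (\<lambda>i. X i \<omega>) [1..<Suc m]) = map (\<lambda>i. X (p i) \<omega>) [1..<Suc m]"
  proof (rule properties_for_sort)
    have "image_mset p (mset_set {1..m}) = mset_set {1..m}"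
      using p by (simp add: image_mset_mset_set permutes_inj_on permutes_image)
    then have "image_mset (\<lambda>i. X i \<omega>) (image_mset p (mset_set {1..m})) =
      image_mset (\<lambda>i. X i \<omega>) (mset_set {1..m})" by simp
    moreover have "mset [1..<Suc m] = mset_set {1..m}"
      by (simp add: mset_upt atLeastLessThanSuc_atLeastAtMost del: upt_Suc)
    ultimately show "mset (map (\<lambda>i. X (p i) \<omega>) [1..<Suc m]) = mset (map (\<lambda>i. X i \<omega>) [1..<Suc m])"
      by (simp add: image_mset.compositionality comp_def del: upt_Suc)
  next
    show "sorted (map (\<lambda>i. X (p i) \<omega>) [1..<Suc m])"
      unfolding sorted_iff_nth_mono_less
    proof (intro allI impI)
      fix i j assume "i < j" "j < length (map (\<lambda>i. X (p i) \<omega>) [1..<Suc m])"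
      then show "map (\<lambda>i. X (p i) \<omega>) [1..<Suc m] ! i \<le> map (\<lambda>i. X (p i) \<omega>) [1..<Suc m] ! j"
        using ranked_less[OF r, of "Suc i" "Suc j"] by (auto simp del: upt_Suc)
    qed
  qed
  moreover have "[1..<Suc m] ! (l - 1) = l" using l by (subst nth_upt) auto
  ultimately show ?thesis using l by (simp add: order_statistic_def del: upt_Suc)
qed

lemma exchangeable_initial:
  assumes ex: "exchangeable M X n" and "m \<le> n" and p: "p permutes {1..m}"
  shows "distr M (PiM {1..m} (\<lambda>_. borel)) (\<lambda>\<omega>. \<lambda>i\<in>{1..m}. X (p i) \<omega>) =
         distr M (PiM {1..m} (\<lambda>_. borel)) (\<lambda>\<omega>. \<lambda>i\<in>{1..m}. X i \<omega>)"
proof -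
  have sub: "{1..m} \<subseteq> {1..n}" using assms(2) by auto
  have pn: "p permutes {1..n}" using p sub by (rule permutes_subset)
  let ?R = "\<lambda>f. restrict f {1..m} :: nat \<Rightarrow> real"
  let ?Q = "PiM {1..n} (\<lambda>_. borel :: real measure)"
  let ?P = "PiM {1..m} (\<lambda>_. borel :: real measure)"
  have R: "?R \<in> measurable ?Q ?P" using sub by (rule measurable_restrict_subset)
  have *: "distr M ?P (\<lambda>\<omega>. \<lambda>i\<in>{1..m}. X (q i) \<omega>) =
      distr (distr M ?Q (\<lambda>\<omega>. \<lambda>i\<in>{1..n}. X (q i) \<omega>)) ?P ?R" if q: "q permutes {1..n}" for q
  proof -
    have "(\<lambda>\<omega>. \<lambda>i\<in>{1..n}. X (q i) \<omega>) \<in> measurable M ?Q"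
    proof (rule measurable_restrict)
      fix i assume "i \<in> {1..n}"
      then have "q i \<in> {1..n}" using permutes_in_image[OF q] by auto
      then show "X (q i) \<in> borel_measurable M" using ex unfolding exchangeable_def by auto
    qed
    then have "distr (distr M ?Q (\<lambda>\<omega>. \<lambda>i\<in>{1..n}. X (q i) \<omega>)) ?P ?R =
      distr M ?P (?R \<circ> (\<lambda>\<omega>. \<lambda>i\<in>{1..n}. X (q i) \<omega>))" using R by (intro distr_distr)
    also have "?R \<circ> (\<lambda>\<omega>. \<lambda>i\<in>{1..n}. X (q i) \<omega>) = (\<lambda>\<omega>. \<lambda>i\<in>{1..m}. X (q i) \<omega>)"
      using sub by (auto simp: fun_eq_iff)
    finally show ?thesis ..
  qed
  have "distr M ?Q (\<lambda>\<omega>. \<lambda>i\<in>{1..n}. X (p i) \<omega>) = distr M ?Q (\<lambda>\<omega>. \<lambda>i\<in>{1..n}. X (id i) \<omega>)"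
    using ex pn unfolding exchangeable_def by simp
  then show ?thesis using *[OF pn] *[OF permutes_id] by simp
qed

lemma mu_eq_expectation_order_statistic:
  assumes "prob_space M" and ex: "exchangeable M X n"
    and int: "\<And>i. i \<in> {1..n} \<Longrightarrow> integrable M (X i)"
    and l: "1 \<le> l" "l \<le> m" and mn: "m \<le> n"
  shows "mu M X l m = (LINT \<omega>|M. order_statistic X l m \<omega>)"
proof -
  interpret M: prob_space M by fact
  define S where "S = {t. t permutes {1..m}}"
  have finS: "finite S" unfolding S_def by (rule finite_permutations) simp
  have neS: "S \<noteq> {}" unfolding S_def using permutes_id by blast
  define U where "U = pmf_of_set S"
  have setU: "set_pmf U = S" using finS neS by (simp add: U_def)
  define N where "N = tie_breaking_space M m"
  have N: "N = M \<Otimes>\<^sub>M measure_pmf U" by (simp add: N_def tie_breaking_space_def U_def S_def)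
  interpret MU: pair_prob_space M "measure_pmf U" ..
  interpret N: prob_space N unfolding N by (rule MU.prob_space_axioms)
  let ?P = "PiM {1..m} (\<lambda>_. borel :: real measure)"
  let ?C = "count_space (UNIV :: (nat \<Rightarrow> nat) set)"
  let ?L = "distr M ?P (\<lambda>\<omega>. \<lambda>i\<in>{1..m}. X i \<omega>)"
  have Xm: "X i \<in> borel_measurable M" if "i \<in> {1..m}" for i
    using ex mn that unfolding exchangeable_def by auto
  have pin: "p i \<in> {1..m}" if "p \<in> S" "i \<in> {1..m}" for p i
    using that permutes_in_image unfolding S_def by (metis mem_Collect_eq)
  define \<Phi> where "\<Phi> p z = (\<lambda>i\<in>{1..m}. X (p i) (fst z), snd z \<circ> p)"
    for p :: "nat \<Rightarrow> nat" and z :: "'a \<times> (nat \<Rightarrow> nat)"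
  have m1: "(\<lambda>\<omega>. \<lambda>i\<in>{1..m}. X (p i) \<omega>) \<in> measurable M ?P" if "p \<in> S" for p
    using that Xm pin by (intro measurable_restrict) blast
  have m2: "(\<lambda>t. t \<circ> p) \<in> measurable (measure_pmf U) ?C" for p by simp
  have \<Phi>m: "\<Phi> p \<in> measurable N (?P \<Otimes>\<^sub>M ?C)" if "p \<in> S" for p
    unfolding \<Phi>_def N
    using measurable_compose[OF measurable_fst m1[OF that]]
      measurable_compose[OF measurable_snd m2[of p]]
    by (intro measurable_Pair) auto
  have dU: "distr (measure_pmf U) ?C (\<lambda>t. t \<circ> p) = measure_pmf U" if "p \<in> S" for p
  proof -
    have pp: "p permutes {1..m}" using that by (simp add: S_def)
    have "inj_on (\<lambda>t. t \<circ> p) S"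
      using permutes_surj[OF pp] by (intro inj_onI) (metis surj_fun_eq)
    moreover have "(\<lambda>t. t \<circ> p) ` S \<subseteq> S"
      using permutes_compose[OF pp] by (auto simp: S_def)
    ultimately have "(\<lambda>t. t \<circ> p) ` S = S" "inj_on (\<lambda>t. t \<circ> p) S"
      using endo_inj_surj[OF finS] by auto
    then have "map_pmf (\<lambda>t. t \<circ> p) U = U"
      unfolding U_def using finS neS by (simp add: map_pmf_of_set_inj)
    moreover have "measure_pmf (map_pmf (\<lambda>t. t \<circ> p) U) = distr (measure_pmf U) ?C (\<lambda>t. t \<circ> p)"
      by (simp add: map_pmf_rep_eq)
    ultimately show ?thesis by simp
  qed
  have dN: "distr N (?P \<Otimes>\<^sub>M ?C) (\<Phi> p) = ?L \<Otimes>\<^sub>M measure_pmf U" if p: "p \<in> S" for p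
  proof -
    have eq: "distr M ?P (\<lambda>\<omega>. \<lambda>i\<in>{1..m}. X (p i) \<omega>) = ?L"
      using exchangeable_initial[OF ex mn] p by (simp add: S_def)
    have "distr M ?P (\<lambda>\<omega>. \<lambda>i\<in>{1..m}. X (p i) \<omega>) \<Otimes>\<^sub>M distr (measure_pmf U) ?C (\<lambda>t. t \<circ> p) =
      distr (M \<Otimes>\<^sub>M measure_pmf U) (?P \<Otimes>\<^sub>M ?C)
        (\<lambda>(\<omega>, t). (\<lambda>i\<in>{1..m}. X (p i) \<omega>, t \<circ> p))"
      by (intro pair_measure_distr m1 m2 p)
        (simp add: dU[OF p] measure_pmf.sigma_finite_measure_axioms)
    also have "(\<lambda>(\<omega>, t). (\<lambda>i\<in>{1..m}. X (p i) \<omega>, t \<circ> p)) = \<Phi> p"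
      by (auto simp: \<Phi>_def fun_eq_iff)
    finally show ?thesis unfolding N eq dU[OF p] by (rule sym)
  qed
  define G where "G = {z \<in> space (?P \<Otimes>\<^sub>M ?C). ranked m (fst z) (snd z)}"
  have Gm: "G \<in> sets (?P \<Otimes>\<^sub>M ?C)"
  proof -
    have c: "(\<lambda>z. fst z i) \<in> borel_measurable (?P \<Otimes>\<^sub>M ?C)" if "i \<in> {1..m}" for i
      using measurable_compose[OF measurable_fst measurable_component_singleton[OF that]] .
    have d: "Measurable.pred (?P \<Otimes>\<^sub>M ?C) (\<lambda>z. snd z i < snd z (Suc i))" for i
      using measurable_compose[OF measurable_snd, of "\<lambda>t. t i < t (Suc i)" ?C "count_space UNIV" ?P]
      by simp
    have "Measurable.pred (?P \<Otimes>\<^sub>M ?C) (\<lambda>z. ranked m (fst z) (snd z))"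
      unfolding ranked_def
    proof (rule pred_intros_finite(3))
      fix i assume i: "i \<in> {1..<m}"
      have [measurable]: "(\<lambda>z. fst z i) \<in> borel_measurable (?P \<Otimes>\<^sub>M ?C)"
        "(\<lambda>z. fst z (Suc i)) \<in> borel_measurable (?P \<Otimes>\<^sub>M ?C)" using i by (auto intro!: c)
      note d[measurable]
      show "Measurable.pred (?P \<Otimes>\<^sub>M ?C) (\<lambda>z. fst z i < fst z (Suc i) \<or>
          fst z i = fst z (Suc i) \<and> snd z i < snd z (Suc i))" by measurable
    qed simp
    then show ?thesis unfolding G_def by (rule predE)
  qed
  define f where "f z = fst z l * indicator G z" for z :: "(nat \<Rightarrow> real) \<times> (nat \<Rightarrow> nat)"
  have fm: "f \<in> borel_measurable (?P \<Otimes>\<^sub>M ?C)"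
  proof -
    have "(\<lambda>z. fst z l) \<in> borel_measurable (?P \<Otimes>\<^sub>M ?C)"
      using measurable_compose[OF measurable_fst measurable_component_singleton] l by auto
    then show ?thesis unfolding f_def using Gm by measurable
  qed
  have G_iff: "\<Phi> p z \<in> G \<longleftrightarrow> ranked m (\<lambda>i. X (p i) (fst z)) (\<lambda>i. snd z (p i))"
    if "z \<in> space N" "p \<in> S" for z p
  proof -
    have "\<Phi> p z \<in> space (?P \<Otimes>\<^sub>M ?C)" using measurable_space[OF \<Phi>m] that by blast
    then have "\<Phi> p z \<in> G \<longleftrightarrow> ranked m (fst (\<Phi> p z)) (snd (\<Phi> p z))" unfolding G_def by simp
    also have "\<dots> \<longleftrightarrow> ranked m (\<lambda>i. X (p i) (fst z)) (\<lambda>i. snd z (p i))"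
      unfolding ranked_def \<Phi>_def by (intro ball_cong) auto
    finally show ?thesis .
  qed
  have uniq: "\<exists>p\<in>S. (\<forall>q\<in>S. \<Phi> q z \<in> G \<longleftrightarrow> q = p) \<and> order_statistic X l m (fst z) = X (p l) (fst z)"
    if z: "z \<in> space N" "snd z \<in> S" for z
  proof -
    have tz: "snd z permutes {1..m}" using z by (simp add: S_def)
    from ex1_ranked_permutation[OF tz, of "\<lambda>i. X i (fst z)"] obtain p
      where p: "p permutes {1..m}" "ranked m (\<lambda>i. X (p i) (fst z)) (\<lambda>i. snd z (p i))"
        "\<And>q. q permutes {1..m} \<Longrightarrow> ranked m (\<lambda>i. X (q i) (fst z)) (\<lambda>i. snd z (q i)) \<Longrightarrow> q = p"
      unfolding Ex1_def by blast
    have "order_statistic X l m (fst z) = X (p l) (fst z)"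
      by (rule order_statistic_eq_ranked[where X = X and \<omega> = "fst z", OF p(1) p(2) l])
    moreover have "\<forall>q\<in>S. \<Phi> q z \<in> G \<longleftrightarrow> q = p"
    proof
      fix q assume q: "q \<in> S"
      show "\<Phi> q z \<in> G \<longleftrightarrow> q = p"
        unfolding G_iff[OF z(1) q] using p(2) p(3)[of q] q unfolding S_def by blast
    qed
    ultimately show ?thesis using p(1) by (auto simp: S_def)
  qed
  have sums: "(\<Sum>q\<in>S. indicator G (\<Phi> q z)) = (1::real)"
      "(\<Sum>q\<in>S. f (\<Phi> q z)) = order_statistic X l m (fst z)"
    if z: "z \<in> space N" "snd z \<in> S" for z
  proof -
    from uniq[OF z] obtain p where p: "p \<in> S" "\<forall>q\<in>S. \<Phi> q z \<in> G \<longleftrightarrow> q = p"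
      "order_statistic X l m (fst z) = X (p l) (fst z)" by blast
    have "(\<Sum>q\<in>S. indicator G (\<Phi> q z)) = (\<Sum>q\<in>S. if q = p then 1 else (0::real))"
      using p(2) by (intro sum.cong) (auto simp: indicator_def)
    then show "(\<Sum>q\<in>S. indicator G (\<Phi> q z)) = (1::real)" using p(1) finS by simp
    have "(\<Sum>q\<in>S. f (\<Phi> q z)) = (\<Sum>q\<in>S. if q = p then X (p l) (fst z) else 0)"
      using p(2) l by (intro sum.cong) (auto simp: f_def indicator_def \<Phi>_def)
    then show "(\<Sum>q\<in>S. f (\<Phi> q z)) = order_statistic X l m (fst z)" using p(1,3) finS by simp
  qed
  have AE_S: "AE z in N. snd z \<in> S"
  proof -
    have "AE t in measure_pmf U. t \<in> S" using setU by (simp add: AE_measure_pmf_iff)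
    then have "AE z in M \<Otimes>\<^sub>M measure_pmf U. snd z \<in> S"
    proof (intro MU.AE_pair_measure)
      have "snd -` S \<inter> space (M \<Otimes>\<^sub>M measure_pmf U) \<in> sets (M \<Otimes>\<^sub>M measure_pmf U)"
        by (rule measurable_sets[OF measurable_snd]) simp
      then show "{z \<in> space (M \<Otimes>\<^sub>M measure_pmf U). snd z \<in> S} \<in> sets (M \<Otimes>\<^sub>M measure_pmf U)"
        by (simp add: vimage_def Int_def conj_commute)
    qed simp
    then show ?thesis unfolding N .
  qed
  have idS: "id \<in> S" unfolding S_def using permutes_id by blast
  have A_eq: "ranking_event M X m = {z \<in> space N. \<Phi> id z \<in> G}"
    using G_iff[OF _ idS] by (auto simp: ranking_event_def N_def[symmetric])
  have A_sets: "ranking_event M X m \<in> sets N"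
  proof -
    have "\<Phi> id -` G \<inter> space N \<in> sets N" using measurable_sets[OF \<Phi>m[OF idS] Gm] .
    moreover have "\<Phi> id -` G \<inter> space N = ranking_event M X m" unfolding A_eq by auto
    ultimately show ?thesis by simp
  qed
  have int_same: "(LINT z|N. h (\<Phi> p z)) = (LINT z|N. h (\<Phi> id z))"
    if "h \<in> borel_measurable (?P \<Otimes>\<^sub>M ?C)" "p \<in> S" for p and h :: "_ \<Rightarrow> real"
    using integral_distr[OF \<Phi>m[OF that(2)] that(1)] integral_distr[OF \<Phi>m[OF idS] that(1)]
      dN[OF that(2)] dN[OF idS] by simp
  have indm: "indicator G \<in> borel_measurable (?P \<Otimes>\<^sub>M ?C)"
    using Gm by (rule borel_measurable_indicator)
  have Xint: "integrable N (\<lambda>z. X i (fst z))" if "i \<in> {1..m}" for i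
  proof -
    have "integrable (distr N M fst) (X i)"
      using int[of i] that mn by (simp add: N measure_pmf.distr_pair_fst)
    then show ?thesis by (rule integrable_distr[rotated]) (simp add: N)
  qed
  have fint: "integrable N (\<lambda>z. f (\<Phi> p z))" if p: "p \<in> S" for p
  proof -
    have "integrable N (\<lambda>z. X (p l) (fst z))" using pin[OF p, of l] l by (intro Xint) auto
    moreover have "(\<lambda>z. f (\<Phi> p z)) \<in> borel_measurable N"
      using measurable_compose[OF \<Phi>m[OF p] fm] .
    moreover have "AE z in N. norm (f (\<Phi> p z)) \<le> norm (X (p l) (fst z))"
      using l by (intro AE_I2) (auto simp: f_def \<Phi>_def indicator_def)
    ultimately show ?thesis by (rule Bochner_Integration.integrable_bound)
  qed
  have iint: "integrable N (\<lambda>z. indicator G (\<Phi> p z) :: real)" if p: "p \<in> S" for p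
    using measurable_compose[OF \<Phi>m[OF p] indm]
    by (intro N.integrable_const_bound[where B = 1]) (auto simp: indicator_def)
  define a where "a = (LINT z|N. indicator G (\<Phi> id z) :: real)"
  define b where "b = (LINT z|N. f (\<Phi> id z))"
  have "real (card S) * a = (\<Sum>p\<in>S. (LINT z|N. indicator G (\<Phi> p z) :: real))"
    using int_same[OF indm] by (simp add: a_def)
  also have "\<dots> = (LINT z|N. (\<Sum>p\<in>S. indicator G (\<Phi> p z) :: real))"
    using iint by (simp add: Bochner_Integration.integral_sum)
  also have "\<dots> = (LINT z|N. 1)"
    using iint by (intro integral_cong_AE AE_mp[OF AE_S AE_I2]) (auto simp: sums(1))
  finally have ca: "real (card S) * a = 1" by (simp add: N.prob_space)
  have OSm: "order_statistic X l m \<in> borel_measurable M"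
  proof -
    have "(\<lambda>\<omega>. (\<omega>, id)) \<in> measurable M N" unfolding N by simp
    then have "(\<lambda>\<omega>. \<Sum>p\<in>S. f (\<Phi> p (\<omega>, id))) \<in> borel_measurable M"
      using measurable_compose[OF _ measurable_compose[OF \<Phi>m fm]]
      by (intro borel_measurable_sum) auto
    moreover have "(\<Sum>p\<in>S. f (\<Phi> p (\<omega>, id))) = order_statistic X l m \<omega>" if "\<omega> \<in> space M" for \<omega>
      using sums(2)[of "(\<omega>, id)"] that idS by (simp add: N space_pair_measure)
    ultimately show ?thesis by (simp cong: measurable_cong)
  qed
  have OSm': "(\<lambda>z. order_statistic X l m (fst z)) \<in> borel_measurable N"
    unfolding N by (rule measurable_compose[OF measurable_fst OSm])
  have "real (card S) * b = (\<Sum>p\<in>S. (LINT z|N. f (\<Phi> p z)))"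
    using int_same[OF fm] by (simp add: b_def)
  also have "\<dots> = (LINT z|N. (\<Sum>p\<in>S. f (\<Phi> p z)))"
    using fint by (simp add: Bochner_Integration.integral_sum)
  also have "\<dots> = (LINT z|N. order_statistic X l m (fst z))"
    using fint OSm' by (intro integral_cong_AE AE_mp[OF AE_S AE_I2]) (auto simp: sums(2))
  also have "\<dots> = (LINT \<omega>|distr N M fst. order_statistic X l m \<omega>)"
    using OSm by (intro integral_distr[symmetric]) (simp_all add: N)
  also have "\<dots> = (LINT \<omega>|M. order_statistic X l m \<omega>)" by (simp add: N measure_pmf.distr_pair_fst)
  finally have cb: "real (card S) * b = (LINT \<omega>|M. order_statistic X l m \<omega>)" .
  have a_meas: "a = measure N (ranking_event M X m)"
  proof -
    have "a = (LINT z|N. indicator (ranking_event M X m) z)"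
      unfolding a_def by (intro Bochner_Integration.integral_cong) (auto simp: A_eq indicator_def)
    then show ?thesis using A_sets by simp
  qed
  have "mu M X l m = (LINT z|N. X l (fst z) * indicator (ranking_event M X m) z) / a"
  proof -
    have pos: "measure N (ranking_event M X m) > 0"
      using ca a_meas by (metis measure_nonneg mult_zero_right order_less_le zero_neq_one)
    have "uniform_measure N (ranking_event M X m) =
      density N (\<lambda>z. ennreal (indicator (ranking_event M X m) z / measure N (ranking_event M X m)))"
      unfolding uniform_measure_def using pos
      by (intro density_cong)
        (use A_sets in \<open>auto simp: N.emeasure_eq_measure divide_ennreal[symmetric] indicator_def\<close>)
    then have "mu M X l m = (LINT z|density N (\<lambda>z. ennreal (indicator (ranking_event M X m) z /
        measure N (ranking_event M X m))). X l (fst z))"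
      by (simp add: mu_def N_def[symmetric])
    also have "\<dots> = (LINT z|N. (indicator (ranking_event M X m) z /
        measure N (ranking_event M X m)) *\<^sub>R X l (fst z))"
      using A_sets Xint[of l] l
      by (intro integral_density) (auto intro!: borel_measurable_divide)
    also have "\<dots> = (LINT z|N. X l (fst z) * indicator (ranking_event M X m) z / a)"
      by (intro Bochner_Integration.integral_cong) (auto simp: a_meas)
    finally show ?thesis by simp
  qed
  also have "(LINT z|N. X l (fst z) * indicator (ranking_event M X m) z) = b"
    unfolding b_def using l
    by (intro Bochner_Integration.integral_cong) (auto simp: A_eq f_def \<Phi>_def indicator_def)
  also have "b / a = real (card S) * b"
    using ca by (metis divide_divide_eq_right mult.commute div_by_1 nonzero_eq_divide_eq
      mult_zero_right zero_neq_one)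
  finally show ?thesis using cb by simp
qed

end

theory Submission
  imports Defs
begin

text \<open>Deleting one of \<open>m + 1\<close> values leaves the \<open>l\<close>-th smallest one unchanged unless the deleted
  value has rank at most \<open>l\<close>, in which case the \<open>(l + 1)\<close>-st smallest takes its place. Averaging
  over the deleted index and using exchangeability gives the triangle rule
  \<open>(m + 1) \<mu>\<^bsub>l:m\<^esub> = (m + 1 - l) \<mu>\<^bsub>l:m+1\<^esub> + l \<mu>\<^bsub>l+1:m+1\<^esub>\<close>, from which the formula follows by
  induction on \<open>j\<close>.\<close>

section \<open>Order statistics: sorting, counting, integrability, deletion of a value\<close>

text \<open>With the identity as tie-breaking priority, \<open>ex1_ranked_permutation\<close> yields
  a single permutation that realises all order statistics at the fixed point \<omega> at
  once.\<close>

lemma sorting_permutation: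
  fixes X :: "nat \<Rightarrow> 'a \<Rightarrow> real"
  obtains p where "p permutes {1..m}"
    and "\<And>l. 1 \<le> l \<Longrightarrow> l \<le> m \<Longrightarrow> order_statistic X l m \<omega> = X (p l) \<omega>"
    and "\<And>i j. 1 \<le> i \<Longrightarrow> i \<le> j \<Longrightarrow> j \<le> m \<Longrightarrow> X (p i) \<omega> \<le> X (p j) \<omega>"
proof -
  obtain p where p: "p permutes {1..m}" "ranked m (\<lambda>i. X (p i) \<omega>) (\<lambda>i. id (p i))"
    using ex1_ranked_permutation[OF permutes_id, of m "\<lambda>i. X i \<omega>"] by blast
  show thesis
  proof (rule that[OF p(1)])
    show "order_statistic X l m \<omega> = X (p l) \<omega>" if "1 \<le> l" "l \<le> m" for l
      by (rule order_statistic_eq_ranked[where X = X and \<omega> = \<omega>, OF p that])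
    show "X (p i) \<omega> \<le> X (p j) \<omega>" if "1 \<le> i" "i \<le> j" "j \<le> m" for i j
      using ranked_less[OF p(2), of i j] that by (cases "i = j") auto
  qed
qed

text \<open>In sorted order the indices with value at most a form an initial segment, so it contains
  position l exactly when it has at least l elements. This turns questions about sorting into
  counting, both for measurability and for deletion.\<close>

lemma order_statistic_le_iff:
  assumes "1 \<le> l" "l \<le> m"
  shows "order_statistic X l m \<omega> \<le> a \<longleftrightarrow> l \<le> card {i\<in>{1..m}. X i \<omega> \<le> a}"
proof -
  obtain p where p1: "p permutes {1..m}"
    and os: "\<And>l. 1 \<le> l \<Longrightarrow> l \<le> m \<Longrightarrow> order_statistic X l m \<omega> = X (p l) \<omega>"
    and mono: "\<And>i j. 1 \<le> i \<Longrightarrow> i \<le> j \<Longrightarrow> j \<le> m \<Longrightarrow> X (p i) \<omega> \<le> X (p j) \<omega>"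
    by (rule sorting_permutation[of m X \<omega>]) (rule that)
  note p = p1 os[OF assms]
  let ?S = "{i\<in>{1..m}. X (p i) \<omega> \<le> a}"
  have "{i\<in>p ` {1..m}. X i \<omega> \<le> a} = p ` ?S" by auto
  then have card: "card {i\<in>{1..m}. X i \<omega> \<le> a} = card ?S"
    unfolding permutes_image[OF p(1)] by (simp add: card_image permutes_inj_on[OF p(1)])
  show ?thesis
  proof (cases "X (p l) \<omega> \<le> a")
    case True
    have "{1..l} \<subseteq> ?S"
    proof
      fix i assume "i \<in> {1..l}"
      then show "i \<in> ?S" using mono[of i l] True assms by auto
    qed
    then have "card {1..l} \<le> card ?S" by (intro card_mono) auto
    then show ?thesis using True card p(2) by simp
  next
    case False
    have "?S \<subseteq> {1..<l}"
    proof
      fix i assume "i \<in> ?S"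
      then show "i \<in> {1..<l}" using mono[of l i] False assms by force
    qed
    then have "card ?S \<le> card {1..<l}" by (intro card_mono) auto
    then show ?thesis using False card p(2) assms by simp
  qed
qed

lemma borel_measurable_order_statistic:
  assumes "\<And>i. i \<in> {1..m} \<Longrightarrow> X i \<in> borel_measurable M" and l: "1 \<le> l" "l \<le> m"
  shows "order_statistic X l m \<in> borel_measurable M"
  unfolding borel_measurable_iff_le
proof
  fix a :: real
  \<comment> \<open>The index set is treated as a random finite set, whose cardinality is measurable
    once each membership is an event.\<close>
  have "{\<omega> \<in> space M. i \<in> {i\<in>{1..m}. X i \<omega> \<le> a}} \<in> sets M" for i
    using assms(1)[of i] by (cases "i \<in> {1..m}") (auto simp: borel_measurable_iff_le)
  then have "(\<lambda>\<omega>. card {i\<in>{1..m}. X i \<omega> \<le> a}) \<in> measurable M (count_space UNIV)"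
    by (rule measurable_card)
  then have "(\<lambda>\<omega>. card {i\<in>{1..m}. X i \<omega> \<le> a}) -` {l..} \<inter> space M \<in> sets M"
    by (rule measurable_sets) simp
  also have "(\<lambda>\<omega>. card {i\<in>{1..m}. X i \<omega> \<le> a}) -` {l..} \<inter> space M =
      {\<omega> \<in> space M. order_statistic X l m \<omega> \<le> a}"
    unfolding order_statistic_le_iff[OF l] by blast
  finally show "{\<omega> \<in> space M. order_statistic X l m \<omega> \<le> a} \<in> sets M" .
qed

text \<open>Pointwise the order statistic is one of the m values, hence dominated by the sum of
  their absolute values.\<close>

lemma integrable_order_statistic:
  fixes X :: "nat \<Rightarrow> 'a \<Rightarrow> real"
  assumes int: "\<And>i. i \<in> {1..m} \<Longrightarrow> integrable M (X i)" and l: "1 \<le> l" "l \<le> m"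
  shows "integrable M (order_statistic X l m)"
proof (rule Bochner_Integration.integrable_bound)
  show "integrable M (\<lambda>\<omega>. \<Sum>i\<in>{1..m}. \<bar>X i \<omega>\<bar>)" using int by auto
  show "order_statistic X l m \<in> borel_measurable M"
    using int l by (intro borel_measurable_order_statistic) auto
  show "AE \<omega> in M. norm (order_statistic X l m \<omega>) \<le> norm (\<Sum>i\<in>{1..m}. \<bar>X i \<omega>\<bar>)"
  proof (rule AE_I2)
    fix \<omega>
    obtain p where p: "p permutes {1..m}" "order_statistic X l m \<omega> = X (p l) \<omega>"
      by (rule sorting_permutation[of m X \<omega>]) (use l in blast)
    have "p l \<in> {1..m}" using permutes_in_image[OF p(1), of l] l by simp
    then have "\<bar>X (p l) \<omega>\<bar> \<le> (\<Sum>i\<in>{1..m}. \<bar>X i \<omega>\<bar>)"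
      by (intro member_le_sum) auto
    then show "norm (order_statistic X l m \<omega>) \<le> norm (\<Sum>i\<in>{1..m}. \<bar>X i \<omega>\<bar>)"
      using p(2) by simp
  qed
qed

text \<open>The transposition moves the value of index \<open>r\<close> out of the first \<open>m\<close> positions.\<close>

lemma order_statistic_delete:
  assumes p: "p permutes {1..Suc m}"
    and os: "\<And>l. 1 \<le> l \<Longrightarrow> l \<le> Suc m \<Longrightarrow> order_statistic X l (Suc m) \<omega> = X (p l) \<omega>"
    and mono: "\<And>i j. 1 \<le> i \<Longrightarrow> i \<le> j \<Longrightarrow> j \<le> Suc m \<Longrightarrow> X (p i) \<omega> \<le> X (p j) \<omega>"
    and l: "1 \<le> l" "l \<le> m" and s: "s \<in> {1..Suc m}" and r: "r = p s"
  shows "order_statistic (\<lambda>i. X (Transposition.transpose r (Suc m) i)) l m \<omega> =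
    (if l < s then order_statistic X l (Suc m) \<omega> else order_statistic X (l + 1) (Suc m) \<omega>)"
    (is "?lhs = ?rhs")
proof -
  let ?\<tau> = "Transposition.transpose r (Suc m)"
  have rin: "r \<in> {1..Suc m}" using permutes_in_image[OF p, of s] s unfolding r by simp
  have \<tau>: "?\<tau> ` {1..m} = {1..Suc m} - {r}"
  proof -
    have "{1..m} = {1..Suc m} - {Suc m}" by auto
    also have "?\<tau> ` \<dots> = ?\<tau> ` {1..Suc m} - ?\<tau> ` {Suc m}"
      by (intro image_set_diff) simp
    also have "?\<tau> ` {1..Suc m} = {1..Suc m}"
      using rin by (intro permutes_image permutes_swap_id) auto
    finally show ?thesis by simp
  qed
  \<comment> \<open>Two reals with the same upper bounds are equal, so it suffices to compare counts
    below each threshold a.\<close>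
  have *: "?lhs \<le> a \<longleftrightarrow> ?rhs \<le> a" for a
  proof -
    let ?T = "{i\<in>{1..Suc m}. X i \<omega> \<le> a}"
    have fin: "finite ?T" by simp
    have "{i\<in>?\<tau> ` {1..m}. X i \<omega> \<le> a} = ?\<tau> ` {i\<in>{1..m}. X (?\<tau> i) \<omega> \<le> a}" by auto
    then have "card {i\<in>{1..m}. X (?\<tau> i) \<omega> \<le> a} = card {i\<in>?\<tau> ` {1..m}. X i \<omega> \<le> a}"
      by (simp add: card_image)
    also have "{i\<in>?\<tau> ` {1..m}. X i \<omega> \<le> a} = ?T - {r}" unfolding \<tau> by auto
    finally have "?lhs \<le> a \<longleftrightarrow> l \<le> card (?T - {r})"
      using order_statistic_le_iff[OF l, of "\<lambda>i. X (?\<tau> i)" \<omega> a] by simp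
    \<comment> \<open>The deleted value has rank s, so deletion lowers the count exactly when s
      \<le> \<open>card ?T\<close>. If l < s, this drop cannot bring the count below l; if s \<le>
      l, reaching l after deletion requires l + 1 before it.\<close>
    moreover have "X (p s) \<omega> \<le> a \<longleftrightarrow> s \<le> card ?T"
      using order_statistic_le_iff[of s "Suc m" X \<omega> a] os[of s] s by simp
    moreover have "r \<in> ?T \<longleftrightarrow> X (p s) \<omega> \<le> a" using rin r by simp
    moreover have "card (?T - {r}) = (if r \<in> ?T then card ?T - 1 else card ?T)"
      by (simp only: card_Diff_singleton_if)
    moreover have "?rhs \<le> a \<longleftrightarrow> (if l < s then l else l + 1) \<le> card ?T"
      using order_statistic_le_iff[of l "Suc m" X \<omega> a]
        order_statistic_le_iff[of "l + 1" "Suc m" X \<omega> a] l by simp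
    ultimately show ?thesis using l by (auto split: if_splits)
  qed
  show ?thesis using *[of ?lhs] *[of ?rhs] by (intro antisym) simp_all
qed

text \<open>Reindexing the deleted index by its rank s makes each summand explicit: m + 1 - l ranks
  lie above l, and l ranks do not.\<close>

lemma sum_order_statistic_delete:
  assumes l: "1 \<le> l" "l \<le> m"
  shows "(\<Sum>r\<in>{1..Suc m}. order_statistic (\<lambda>i. X (Transposition.transpose r (Suc m) i)) l m \<omega>) =
    real (Suc m - l) * order_statistic X l (Suc m) \<omega> +
    real l * order_statistic X (l + 1) (Suc m) \<omega>"
proof -
  let ?a = "order_statistic X l (Suc m) \<omega>" and ?b = "order_statistic X (l + 1) (Suc m) \<omega>"
  obtain p where p: "p permutes {1..Suc m}"
    "\<And>l. 1 \<le> l \<Longrightarrow> l \<le> Suc m \<Longrightarrow> order_statistic X l (Suc m) \<omega> = X (p l) \<omega>"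
    "\<And>i j. 1 \<le> i \<Longrightarrow> i \<le> j \<Longrightarrow> j \<le> Suc m \<Longrightarrow> X (p i) \<omega> \<le> X (p j) \<omega>"
    by (rule sorting_permutation[of "Suc m" X \<omega>]) (rule that)
  have "(\<Sum>r\<in>{1..Suc m}. order_statistic (\<lambda>i. X (Transposition.transpose r (Suc m) i)) l m \<omega>) =
    (\<Sum>s\<in>{1..Suc m}. order_statistic (\<lambda>i. X (Transposition.transpose (p s) (Suc m) i)) l m \<omega>)"
    using sum.permute[OF p(1), of "\<lambda>r. order_statistic (\<lambda>i. X (Transposition.transpose r (Suc m) i)) l m \<omega>"]
    by (simp only: comp_def)
  also have "\<dots> = (\<Sum>s\<in>{1..Suc m}. if l < s then ?a else ?b)"
    by (intro sum.cong order_statistic_delete[OF p l]) auto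
  also have "\<dots> = (\<Sum>s\<in>{1..Suc m} \<inter> {s. l < s}. ?a) + (\<Sum>s\<in>{1..Suc m} \<inter> - {s. l < s}. ?b)"
    by (rule sum.If_cases) simp
  also have "{1..Suc m} \<inter> {s. l < s} = {Suc l..Suc m}" by auto
  also have "{1..Suc m} \<inter> - {s. l < s} = {1..l}" using l by auto
  finally show ?thesis by simp
qed

section \<open>Exchangeability and the triangle rule\<close>

text \<open>An order statistic is a Borel function of the vector of all n variables, so its
  expectation depends only on the joint law, which exchangeability keeps fixed.\<close>

lemma expectation_order_statistic_permute:
  assumes ex: "exchangeable M X n" and q: "q permutes {1..n}"
    and l: "1 \<le> l" "l \<le> m" and mn: "m \<le> n"
  shows "(LINT \<omega>|M. order_statistic (\<lambda>i. X (q i)) l m \<omega>) = (LINT \<omega>|M. order_statistic X l m \<omega>)"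
proof -
  let ?P = "PiM {1..n} (\<lambda>_. borel :: real measure)"
  let ?F = "order_statistic (\<lambda>i x. x i) l m :: (nat \<Rightarrow> real) \<Rightarrow> real"
  have F: "?F \<in> borel_measurable ?P"
    using l mn by (intro borel_measurable_order_statistic measurable_component_singleton) auto
  have *: "(LINT \<omega>|M. order_statistic (\<lambda>i. X (s i)) l m \<omega>) =
      (LINT x|distr M ?P (\<lambda>\<omega>. \<lambda>i\<in>{1..n}. X (s i) \<omega>). ?F x)" if s: "s permutes {1..n}" for s
  proof -
    have "(\<lambda>\<omega>. \<lambda>i\<in>{1..n}. X (s i) \<omega>) \<in> measurable M ?P"
    proof (rule measurable_restrict)
      fix i assume "i \<in> {1..n}"
      then have "s i \<in> {1..n}" using permutes_in_image[OF s, of i] by simp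
      then show "X (s i) \<in> borel_measurable M" using ex unfolding exchangeable_def by auto
    qed
    then have "(LINT x|distr M ?P (\<lambda>\<omega>. \<lambda>i\<in>{1..n}. X (s i) \<omega>). ?F x) =
        (LINT \<omega>|M. ?F (\<lambda>i\<in>{1..n}. X (s i) \<omega>))"
      using F by (rule integral_distr)
    \<comment> \<open>The restriction to \<open>{1..n}\<close> is harmless because only coordinates
      up to m \<le> n are read.\<close>
    moreover have "?F (\<lambda>i\<in>{1..n}. X (s i) \<omega>) = order_statistic (\<lambda>i. X (s i)) l m \<omega>" for \<omega>
    proof -
      have "map (\<lambda>i. (\<lambda>i\<in>{1..n}. X (s i) \<omega>) i) [1..<Suc m] = map (\<lambda>i. X (s i) \<omega>) [1..<Suc m]"
        using mn by (intro map_cong) auto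
      then show ?thesis unfolding order_statistic_def by (simp only:)
    qed
    ultimately show ?thesis by simp
  qed
  show ?thesis
    using *[OF q] *[OF permutes_id] ex q unfolding exchangeable_def by simp
qed

lemma mu_triangle_rule:
  assumes M: "prob_space M" and ex: "exchangeable M X n"
    and int: "\<And>i. i \<in> {1..n} \<Longrightarrow> integrable M (X i)"
    and l: "1 \<le> l" "l \<le> m" and mn: "Suc m \<le> n"
  shows "real (Suc m) * mu M X l m =
    real (Suc m - l) * mu M X l (Suc m) + real l * mu M X (l + 1) (Suc m)"
proof -
  have mu: "mu M X i m' = (LINT \<omega>|M. order_statistic X i m' \<omega>)"
    if "1 \<le> i" "i \<le> m'" "m' \<le> n" for i m'
    using M ex int that by (rule mu_eq_expectation_order_statistic)
  let ?O = "\<lambda>r. order_statistic (\<lambda>i. X (Transposition.transpose r (Suc m) i)) l m"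
  have \<tau>: "Transposition.transpose r (Suc m) permutes {1..n}" if "r \<in> {1..Suc m}" for r
    using that mn by (intro permutes_swap_id) auto
  have intO: "integrable M (?O r)" if r: "r \<in> {1..Suc m}" for r
  proof (rule integrable_order_statistic[OF _ l])
    fix i assume "i \<in> {1..m}"
    then have "Transposition.transpose r (Suc m) i \<in> {1..n}"
      using permutes_in_image[OF \<tau>[OF r], of i] mn by auto
    then show "integrable M (X (Transposition.transpose r (Suc m) i))" by (rule int)
  qed
  have ints: "integrable M (order_statistic X i (Suc m))" if "1 \<le> i" "i \<le> Suc m" for i
    using that mn int by (intro integrable_order_statistic) auto
  \<comment> \<open>Since \<open>Suc m\<close> \<le> n, the transposition permutes
    \<open>{1..n}\<close>, so all m + 1 deletions have the same expectation.\<close>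
  have "(LINT \<omega>|M. ?O r \<omega>) = mu M X l m" if r: "r \<in> {1..Suc m}" for r
    using expectation_order_statistic_permute[OF ex \<tau>[OF r] l] mu[OF l] mn by simp
  then have "(\<Sum>r\<in>{1..Suc m}. LINT \<omega>|M. ?O r \<omega>) = (\<Sum>r\<in>{1..Suc m}. mu M X l m)"
    by (intro sum.cong refl)
  then have "real (Suc m) * mu M X l m = (\<Sum>r\<in>{1..Suc m}. LINT \<omega>|M. ?O r \<omega>)"
    by (simp only: sum_constant card_atLeastAtMost diff_Suc_1)
  also have "\<dots> = (LINT \<omega>|M. (\<Sum>r\<in>{1..Suc m}. ?O r \<omega>))"
    using intO by (intro Bochner_Integration.integral_sum[symmetric]) auto
  also have "\<dots> = (LINT \<omega>|M. (real (Suc m - l) * order_statistic X l (Suc m) \<omega> +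
      real l * order_statistic X (l + 1) (Suc m) \<omega>))"
    by (simp only: sum_order_statistic_delete[OF l])
  also have "\<dots> = real (Suc m - l) * mu M X l (Suc m) + real l * mu M X (l + 1) (Suc m)"
    using ints[of l] ints[of "l + 1"] l mn by (simp add: mu)
  finally show ?thesis .
qed

section \<open>Induction on the order of the derivative\<close>

theorem proposition2p2:
  fixes M :: "'a measure" and X :: "nat \<Rightarrow> 'a \<Rightarrow> real" and n k j :: nat
  assumes "prob_space M"
    and "exchangeable M X n"
    and "\<And>i. i \<in> {1..n} \<Longrightarrow> integrable M (X i)"
    and "1 \<le> k" and "1 \<le> j" and "k + j \<le> n"
  shows "(discrete_deriv ^^ j) (mu_max M X) k =
    inverse (real ((k + j) choose j)) * (- 1) ^ (j + 1) *
      (mu M X (k + 1) (k + j) - mu M X k (k + j))"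
  using assms(5,4,6)
proof (induction j arbitrary: k rule: dec_induct)
  case base
  have "real (Suc k) * mu M X k k = mu M X k (Suc k) + real k * mu M X (Suc k) (Suc k)"
    using mu_triangle_rule[OF assms(1-3), of k k] base by simp
  then have "real (Suc k) * (mu M X (Suc k) (Suc k) - mu M X k k) =
      mu M X (Suc k) (Suc k) - mu M X k (Suc k)"
    by (simp add: algebra_simps)
  then show ?case
    by (simp add: discrete_deriv_def mu_max_def field_simps del: of_nat_Suc)
next
  case (step j)
  let ?m = "k + j"
  let ?D = "\<lambda>k m. mu M X (k + 1) m - mu M X k m"
  let ?c = "real (Suc ?m choose j)" and ?d = "real (Suc ?m choose Suc j)"
    and ?e = "real (?m choose j)"
  have "real (Suc ?m) * mu M X k ?m =
      real (Suc j) * mu M X k (Suc ?m) + real k * mu M X (k + 1) (Suc ?m)"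
    using mu_triangle_rule[OF assms(1-3), of k ?m] step.prems by (simp add: Suc_diff_le)
  \<comment> \<open>The rule at l = k + 1 requires k + 1 \<le> k + j, which holds because the
    induction starts at j = 1.\<close>
  moreover have "real (Suc ?m) * mu M X (k + 1) ?m =
      real j * mu M X (k + 1) (Suc ?m) + real (Suc k) * mu M X (k + 2) (Suc ?m)"
    using mu_triangle_rule[OF assms(1-3), of "k + 1" ?m] step.prems step.hyps by simp
  ultimately have rec: "real (Suc ?m) * ?D k ?m =
      real (Suc k) * ?D (k + 1) (Suc ?m) + real (Suc j) * ?D k (Suc ?m)"
    by (simp add: algebra_simps)
  \<comment> \<open>Absorption identities: \<open>?e\<close> and \<open>?c\<close> are the binomials
    of the induction hypothesis at k and k + 1, and \<open>?d\<close> is that of the goal. They turn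
    the integer weights of \<open>rec\<close> into inverse binomials.\<close>
  have c: "real (Suc k) * ?c = real (Suc ?m) * ?e"
    using binomial_absorb_comp[of "Suc ?m" j] unfolding of_nat_mult[symmetric]
    by (simp add: Suc_diff_le)
  have d: "real (Suc j) * ?d = real (Suc ?m) * ?e"
    using Suc_times_binomial_eq[of ?m j] unfolding of_nat_mult[symmetric]
    by (metis mult.commute)
  \<comment> \<open>Both sides are the inverse of the same product.\<close>
  have swap: "inverse e / b = inverse c / a" if "a * c = b * e" for a b c e :: real
    using that by (metis divide_inverse inverse_mult_distrib mult.commute)
  note inv = swap[OF c] swap[OF d]
  have "inverse ?e * ?D k ?m = inverse ?e / real (Suc ?m) * (real (Suc ?m) * ?D k ?m)"
    by simp
  also have "\<dots> = inverse ?e / real (Suc ?m) * real (Suc k) * ?D (k + 1) (Suc ?m) +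
      inverse ?e / real (Suc ?m) * real (Suc j) * ?D k (Suc ?m)"
    unfolding rec by (simp only: distrib_left mult.assoc)
  also have "\<dots> = inverse ?c * ?D (k + 1) (Suc ?m) + inverse ?d * ?D k (Suc ?m)"
    by (subst inv(1), subst inv(2)) (simp del: of_nat_Suc binomial_Suc_Suc)
  finally have key: "inverse ?e * ?D k ?m =
      inverse ?c * ?D (k + 1) (Suc ?m) + inverse ?d * ?D k (Suc ?m)" .
  have "(discrete_deriv ^^ Suc j) (mu_max M X) k =
      (discrete_deriv ^^ j) (mu_max M X) (k + 1) - (discrete_deriv ^^ j) (mu_max M X) k"
    by (simp add: discrete_deriv_def)
  also have "\<dots> = (- 1) ^ (j + 1) * (inverse ?c * ?D (k + 1) (Suc ?m) - inverse ?e * ?D k ?m)"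
    using step.IH[of k] step.IH[of "k + 1"] step.prems
    by (simp add: algebra_simps del: binomial_Suc_Suc)
  \<comment> \<open>Inserting \<open>key\<close> cancels the \<open>?c\<close> terms; the surviving
    \<open>?d\<close> term enters negatively, which supplies the extra sign.\<close>
  also have "\<dots> = inverse ?d * (- 1) ^ (Suc j + 1) * ?D k (Suc ?m)"
    unfolding key by (simp del: binomial_Suc_Suc)
  finally show ?case by simp
qed

end
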